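(* Let $\mathcal{O}\subset\mathcal{P}^*$ be open, $T_*\in(0,\infty]$, $T\in(0,T_* )$, and let $\boldsymbol{F}:\mathcal{O}\times[0,T_* )\to\mathbb{R}^N$ be continuous with the local Lipschitz property described in the context. Let $\mathcal{K}$ be a compact set in $\mathcal{O}$, let $\varepsilon\in(0,\rho(\mathcal{K},\mathcal{O}))$, and define $$\mathcal{K}_\varepsilon:=\overline{\bigcup_{\Sigma\in\mathcal{K}}B(\Sigma,\varepsilon)}.$$ Let $0=t_0<t_1<\cdots<t_{\bar m}\le T$ be time steps, fix $m<\bar m$, put $\tau_m:=t_{m+1}-t_m$ and $t_{m+1/2}:=t_m+\tau_m/2$, and assume that $\Gamma^m\in\mathcal{K}$ and $$\tau_m\le\min\left\{\frac{\varepsilon}{M(\mathcal{K}_\varepsilon,T)},\ \frac{2\lambda}{L(\mathcal{K}_\varepsilon,T)}\right\},$$ where $\lambda\in(0,1)$. Then there exists a unique $\Gamma^{m+1}\in\overline{B(\Gamma^m,\varepsilon)}$ satisfying $$\boldsymbol{h}(\Gamma^{m+1})=\boldsymbol{h}(\Gamma^m)+\tau_m\,\boldsymbol{F}\left(\frac{\Gamma^m+\Gamma^{m+1}}{2},\,t_{m+1/2}\right).$$ Furthermore, define $\Lambda_m(\Sigma)\in\mathcal{O}$ for $\Sigma\in\overline{B(\Gamma^m,\varepsilon)}$ by $$\boldsymbol{h}(\Lambda_m(\Sigma))=\boldsymbol{h}(\Gamma^m)+\tau_m\,\boldsymbol{F}\left(\frac{\Gamma^m+\Sigma}{2},\,t_{m+1/2}\right).$$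 Then $\Lambda_m$ is a contraction of $\overline{B(\Gamma^m,\varepsilon)}$ into itself, $\Gamma^{m+1}$ is a fixed point of $\Lambda_m$ in $\overline{B(\Gamma^m,\varepsilon)}$, and $\Gamma^{m+1}$ is the limit of $\Lambda_m^\nu(\Gamma^m)$ as $\nu\to\infty$, with $$d(\Gamma^{m+1},\Lambda_m^\nu(\Gamma^m))\le\lambda^\nu\,d(\Gamma^{m+1},\Gamma^m)\qquad(\nu\in\mathbb{N}).$$
   Context: $\mathcal{P}$ is the set of all polygonal Jordan curves in $\mathbb{R}^2$. For an $N$-polygon $\Gamma\in\mathcal{P}$, vertices $\boldsymbol{w}_j$ are numbered counterclockwise (periodic index convention modulo $N$), $\Gamma_j$ is the open edge between $\boldsymbol{w}_{j-1}$ and $\boldsymbol{w}_j$ with outward unit normal $\boldsymbol{n}_j$; consecutive edges are not parallel (outer angles lie in $(-\pi,\pi)\setminus\{0\}$); the height of $\Gamma_j$ is $h_j:=\boldsymbol{w}_j\cdot\boldsymbol{n}_j=\boldsymbol{w}_{j-1}\cdot\boldsymbol{n}_j$. Polygons are equivalent if they have the same number of edges and, after suitable counterclockwise numbering, the same normals $\boldsymbol{n}_j$ for all $j$. $\mathcal{P}^*$ denotes a fixed equivalence class of $N$-polygons, numbered consistently. The height function $\boldsymbol{h}(\Gamma)=(h_1(\Gamma),\dots,h_N(\Gamma))\in\mathbb{R}^N$ is injective on $\mathcal{P}^*$ with open image, and $\mathcal{P}^*$ carries the metric $d(\Gamma,\Sigma)=|\boldsymbol{h}(\Gamma)-\boldsymbol{h}(\Sigma)|_\infty$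 (maximum norm). $B(\Gamma,\varepsilon)=\{\Sigma\in\mathcal{P}^*:d(\Sigma,\Gamma)<\varepsilon\}$; an overline denotes closure in $\mathcal{P}^*$. The interpolation $(\Gamma+\Sigma)/2$, if it exists, is the element of $\mathcal{P}^*$ with height vector $(\boldsymbol{h}(\Gamma)+\boldsymbol{h}(\Sigma))/2$. For $\Gamma\in\mathcal{O}$, $\rho(\Gamma,\mathcal{O}):=\inf\{|\boldsymbol{a}-\boldsymbol{h}(\Gamma)|_\infty:\boldsymbol{a}\in\mathbb{R}^N\setminus\boldsymbol{h}(\mathcal{O})\}>0$, and for compact $\mathcal{K}\subset\mathcal{O}$, $\rho(\mathcal{K},\mathcal{O}):=\min_{\Gamma\in\mathcal{K}}\rho(\Gamma,\mathcal{O})$. Local Lipschitz property: for every compact $\mathcal{K}\subset\mathcal{O}$ and $T\in(0,T_* )$ there is a constant (fixed once and for all) $L(\mathcal{K},T)>0$ with $|\boldsymbol{F}(\Gamma,t)-\boldsymbol{F}(\Sigma,t)|_\infty\le L(\mathcal{K},T)\,d(\Gamma,\Sigma)$ for $\Gamma,\Sigma\in\mathcal{K}$, $t\in[0,T]$. Also $M(\mathcal{K},T):=\max\{|\boldsymbol{F}(\Gamma,t)|_\infty:\Gamma\in\mathcal{K},\ t\in[0,T]\}$, understood to be positive. *)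

theory Defs
  imports "HOL-Complex_Analysis.Complex_Analysis"
begin

section \<open>Polygonal Jordan curves and their numberings\<close>

fun polygonal_path :: "'a::real_normed_vector list \<Rightarrow> real \<Rightarrow> 'a" where
  "polygonal_path [] = linepath 0 0"
| "polygonal_path [a] = linepath a a"
| "polygonal_path [a, b] = linepath a b"
| "polygonal_path (a # b # c # vs) = linepath a b +++ polygonal_path (b # c # vs)"

definition polygonal_Jordan_curves :: "(real^2) set set" where
  "polygonal_Jordan_curves =
     {path_image (polygonal_path vs) | vs.
        simple_path (polygonal_path vs) \<and>
        pathfinish (polygonal_path vs) = pathstart (polygonal_path vs)}"

definition to_complex :: "real^2 \<Rightarrow> complex" where
  "to_complex x = Complex (x $ 1) (x $ 2)"

definition outward_unit_normal :: "(real^2) set \<Rightarrow> real^2 \<Rightarrow> real^2 \<Rightarrow> real^2 \<Rightarrow> bool" where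
  "outward_unit_normal \<Gamma> a b \<nu> \<longleftrightarrow>
     norm \<nu> = 1 \<and> \<nu> \<bullet> (b - a) = 0 \<and>
     (\<forall>x \<in> open_segment a b. eventually (\<lambda>s. x + s *\<^sub>R \<nu> \<in> outside \<Gamma>) (at_right 0))"

text \<open>
  \<open>ccw_polygon N w n \<Gamma>\<close>: the curve \<open>\<Gamma>\<close> is an \<open>N\<close>-polygon, \<open>w\<close> is a counterclockwise numbering of
  its vertices, extended periodically to all integers, and \<open>n j\<close> is the outward unit normal of
  the edge between \<open>w (j - 1)\<close> and \<open>w j\<close>.  Non-collinearity of consecutive vertices says that
  the outer angles lie in $(-\pi,\pi)$ without $0$ (the value $\pm\pi$ being excluded already
  because the curve is simple).  Simplicity also forces \<open>N \<ge> 3\<close>.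
\<close>

definition ccw_polygon :: "nat \<Rightarrow> (int \<Rightarrow> real^2) \<Rightarrow> (int \<Rightarrow> real^2) \<Rightarrow> (real^2) set \<Rightarrow> bool" where
  "ccw_polygon N w n \<Gamma> \<longleftrightarrow>
     (\<forall>j. w (j + int N) = w j) \<and>
     (let p = polygonal_path (map w [0..int N]) in
        simple_path p \<and> path_image p = \<Gamma> \<and>
        (\<forall>z \<in> inside \<Gamma>. winding_number (to_complex \<circ> p) (to_complex z) = 1)) \<and>
     (\<forall>j. \<not> collinear {w (j - 1), w j, w (j + 1)}) \<and>
     (\<forall>j. outward_unit_normal \<Gamma> (w (j - 1)) (w j) (n j))"

definition polygon_equiv :: "((real^2) set \<times> (real^2) set) set" where
  "polygon_equiv =
     {(\<Gamma>, \<Sigma>). \<exists>N w v n. ccw_polygon N w n \<Gamma> \<and> ccw_polygon N v n \<Sigma>}"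

text \<open>
  A consistently numbered equivalence class of \<open>N\<close>-polygons: \<open>w \<Gamma>\<close> is the numbering of the
  vertices of \<open>\<Gamma>\<close>, and \<open>n\<close> is the sequence of normals shared by all members of the class.
\<close>

definition numbered_polygon_class ::
    "nat \<Rightarrow> (real^2) set set \<Rightarrow> ((real^2) set \<Rightarrow> int \<Rightarrow> real^2) \<Rightarrow> (int \<Rightarrow> real^2) \<Rightarrow> bool" where
  "numbered_polygon_class N P w n \<longleftrightarrow>
     P \<in> polygonal_Jordan_curves // polygon_equiv \<and> (\<forall>\<Gamma>\<in>P. ccw_polygon N (w \<Gamma>) n \<Gamma>)"

section \<open>Heights and the metric space of an equivalence class\<close>

text \<open>
  Height vectors live in \<open>real^'n\<close> with \<open>CARD('n) = N\<close>; the bijection \<open>\<kappa>\<close> from \<open>'n\<close> onto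
  $\{1,\dots,N\}$ says which coordinate carries which edge.
\<close>

definition heights :: "('n \<Rightarrow> int) \<Rightarrow> (int \<Rightarrow> real^2) \<Rightarrow> (int \<Rightarrow> real^2) \<Rightarrow> real^'n::finite" where
  "heights \<kappa> n w = (\<chi> i. w (\<kappa> i) \<bullet> n (\<kappa> i))"

text \<open>
  In the remaining definitions \<open>h\<close> is the height function and \<open>P\<close> the equivalence class.  Recall
  that \<open>infnorm\<close> is the maximum norm.
\<close>

definition hdist :: "('a \<Rightarrow> real^'n) \<Rightarrow> 'a \<Rightarrow> 'a \<Rightarrow> real" where
  "hdist h \<Gamma> \<Sigma> = infnorm (h \<Gamma> - h \<Sigma>)"

definition htopology :: "'a set \<Rightarrow> ('a \<Rightarrow> real^'n) \<Rightarrow> 'a topology" where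
  "htopology P h = Metric_space.mtopology P (hdist h)"

definition hball :: "'a set \<Rightarrow> ('a \<Rightarrow> real^'n) \<Rightarrow> 'a \<Rightarrow> real \<Rightarrow> 'a set" where
  "hball P h \<Gamma> \<epsilon> = Metric_space.mball P (hdist h) \<Gamma> \<epsilon>"

definition is_interpolation :: "'a set \<Rightarrow> ('a \<Rightarrow> real^'n) \<Rightarrow> 'a \<Rightarrow> 'a \<Rightarrow> 'a \<Rightarrow> bool" where
  "is_interpolation P h \<Gamma> \<Sigma> \<Theta> \<longleftrightarrow> \<Theta> \<in> P \<and> h \<Theta> = (1/2) *\<^sub>R (h \<Gamma> + h \<Sigma>)"

definition interpolation :: "'a set \<Rightarrow> ('a \<Rightarrow> real^'n) \<Rightarrow> 'a \<Rightarrow> 'a \<Rightarrow> 'a" where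
  "interpolation P h \<Gamma> \<Sigma> = (THE \<Theta>. is_interpolation P h \<Gamma> \<Sigma> \<Theta>)"

text \<open>
  The infimum in \<open>rho_point\<close> is over a nonempty set, because \<open>0\<close> is never the height vector of a
  polygon.  The infimum in \<open>rho\<close> and the supremum in \<open>maxF\<close> are attained when \<open>K\<close> is nonempty
  and compact and \<open>F\<close> is continuous.
\<close>

definition rho_point :: "('a \<Rightarrow> real^'n) \<Rightarrow> 'a \<Rightarrow> 'a set \<Rightarrow> real" where
  "rho_point h \<Gamma> U = Inf {infnorm (a - h \<Gamma>) | a. a \<in> UNIV - h ` U}"

definition rho :: "('a \<Rightarrow> real^'n) \<Rightarrow> 'a set \<Rightarrow> 'a set \<Rightarrow> real" where
  "rho h K U = (INF \<Gamma>\<in>K. rho_point h \<Gamma> U)"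

definition maxF :: "('a \<Rightarrow> real \<Rightarrow> real^'n) \<Rightarrow> 'a set \<Rightarrow> real \<Rightarrow> real" where
  "maxF F K T = Sup {infnorm (F \<Gamma> t) | \<Gamma> t. \<Gamma> \<in> K \<and> t \<in> {0..T}}"

text \<open>\<open>L K T\<close> is the Lipschitz constant chosen for \<open>K\<close> and \<open>T\<close>.\<close>

definition locally_Lipschitz_with ::
    "'a set \<Rightarrow> ('a \<Rightarrow> real^'n) \<Rightarrow> 'a set \<Rightarrow> ereal \<Rightarrow> ('a \<Rightarrow> real \<Rightarrow> real^'n) \<Rightarrow>
     ('a set \<Rightarrow> real \<Rightarrow> real) \<Rightarrow> bool" where
  "locally_Lipschitz_with P h U Tstar F L \<longleftrightarrow>
     (\<forall>K T. compactin (htopology P h) K \<and> K \<subseteq> U \<and> 0 < T \<and> ereal T < Tstar \<longrightarrow>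
        0 < L K T \<and>
        (\<forall>\<Gamma>\<in>K. \<forall>\<Sigma>\<in>K. \<forall>t\<in>{0..T}. infnorm (F \<Gamma> t - F \<Sigma> t) \<le> L K T * hdist h \<Gamma> \<Sigma>))"

end

theory Submission
  imports Defs
begin

text \<open>
  Everything is read off in the space of height vectors. A polygon of the class is determined by
  its heights, because two consecutive edges are not parallel and so their two lines, which normals
  and heights fix, meet in exactly one vertex (\<open>heights_inj_on_numbered_class\<close>). The maximum norm
  of height differences is therefore a metric, and the height function is an isometry of the class
  onto a set of vectors under that norm (locale \<open>height_embedding\<close>).

  The number \<open>\<rho>(K, U)\<close> measures the room around \<open>K\<close>: every vector at distance less than
  \<open>\<rho>(K, U)\<close> from the heights of a member of \<open>K\<close> is the height vector of a member of \<open>U\<close>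
  (\<open>height_mem_image_if_lt_rho\<close>). Since \<open>\<epsilon> < \<rho>(K, U)\<close>, the closure of the ball around \<open>\<Gamma>\<^sub>m\<close>
  corresponds to a full closed ball of vectors, which is convex and so contains the midpoints that
  the scheme needs. For the same reason the heights of \<open>K\<^sub>\<epsilon>\<close> lie in the compact sum of the heights
  of \<open>K\<close> and a closed ball, and this sum consists of heights of members of \<open>U\<close>. Hence \<open>K\<^sub>\<epsilon>\<close> is a
  compact subset of \<open>U\<close> (\<open>compactin_closure_of_balls\<close>), and the supremum of \<open>F\<close> and its Lipschitz
  constant on \<open>K\<^sub>\<epsilon>\<close> are genuine bounds.

  The two step size restrictions are then the two hypotheses of the contraction principle
  (\<open>contraction_on_compact\<close>). From \<open>\<tau> M \<le> \<epsilon>\<close> it follows that no value of \<open>\<Lambda>\<close> is further than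
  \<open>\<epsilon>\<close> from \<open>\<Gamma>\<^sub>m\<close>, so that the closed ball is mapped into itself. Taking the midpoint with the
  fixed \<open>\<Gamma>\<^sub>m\<close> halves distances, so that \<open>\<Lambda>\<close> has Lipschitz constant \<open>\<tau> L / 2 \<le> \<lambda>\<close>.
\<close>

section \<open>Polygons are determined by their heights\<close>

lemma plane_orthogonal_imp_multiple:
  fixes a u \<nu> :: "real^2"
  assumes "\<nu> \<noteq> 0" "u \<noteq> 0" "u \<bullet> \<nu> = 0" "a \<bullet> \<nu> = 0"
  obtains c where "a = c *\<^sub>R u"
proof -
  have u: "u$1 * \<nu>$1 + u$2 * \<nu>$2 = 0" and a: "a$1 * \<nu>$1 + a$2 * \<nu>$2 = 0"
    using assms(3,4) by (simp_all add: inner_vec_def sum_2)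
  have "(a$1 * u$2 - a$2 * u$1) * \<nu>$1 = 0" "(a$1 * u$2 - a$2 * u$1) * \<nu>$2 = 0"
    using u a by algebra+
  moreover have "\<nu>$1 \<noteq> 0 \<or> \<nu>$2 \<noteq> 0"
    using \<open>\<nu> \<noteq> 0\<close> by (auto simp: vec_eq_iff forall_2)
  ultimately have det: "a$1 * u$2 = a$2 * u$1"
    by auto
  have pos: "u$1 * u$1 + u$2 * u$2 \<noteq> 0"
    using \<open>u \<noteq> 0\<close> by (auto simp: vec_eq_iff forall_2 sum_squares_eq_zero_iff)
  define c where "c = (a$1 * u$1 + a$2 * u$2) / (u$1 * u$1 + u$2 * u$2)"
  have "(a$1 * u$1 + a$2 * u$2) * u$1 = a$1 * (u$1 * u$1 + u$2 * u$2)"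
       "(a$1 * u$1 + a$2 * u$2) * u$2 = a$2 * (u$1 * u$1 + u$2 * u$2)"
    using det by algebra+
  then have "a = c *\<^sub>R u"
    using pos by (simp add: vec_eq_iff forall_2 c_def)
  then show thesis
    by (rule that)
qed

lemma ccw_polygonD:
  assumes "ccw_polygon N w n \<Gamma>"
  shows "w (j + int N) = w j"
    and "path_image (polygonal_path (map w [0..int N])) = \<Gamma>"
    and "\<not> collinear {w (j - 1), w j, w (j + 1)}"
    and "n j \<noteq> 0"
    and "(w j - w (j - 1)) \<bullet> n j = 0"
proof -
  have "norm (n j) = 1"
    using assms by (simp add: ccw_polygon_def outward_unit_normal_def)
  then show "n j \<noteq> 0"
    by auto
qed (use assms in \<open>auto simp: ccw_polygon_def outward_unit_normal_def Let_def inner_commute\<close>)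

text \<open>
  Both sides of a genuine corner would otherwise be multiples of \<open>u\<close>. Applied to the difference
  \<open>u\<close> of two candidate vertices, this says that two lines with these normals meet only once.
\<close>
lemma orthogonal_to_noncollinear_normals:
  fixes a b c u \<mu> \<nu> :: "real^2"
  assumes "\<not> collinear {a, b, c}"
    and "\<mu> \<noteq> 0" "(b - a) \<bullet> \<mu> = 0" and "\<nu> \<noteq> 0" "(c - b) \<bullet> \<nu> = 0"
    and "u \<bullet> \<mu> = 0" "u \<bullet> \<nu> = 0"
  shows "u = 0"
proof (rule ccontr)
  assume "u \<noteq> 0"
  obtain r where r: "b - a = r *\<^sub>R u"
    using plane_orthogonal_imp_multiple[of \<mu> u "b - a"] assms \<open>u \<noteq> 0\<close> by metis
  obtain s where s: "c - b = s *\<^sub>R u"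
    using plane_orthogonal_imp_multiple[of \<nu> u "c - b"] assms \<open>u \<noteq> 0\<close> by metis
  have "a = b + (- r) *\<^sub>R u" "b = b + 0 *\<^sub>R u" "c = b + s *\<^sub>R u"
    using r s by (simp_all add: algebra_simps)
  then have "collinear {a, b, c}"
    unfolding collinear_alt by blast
  then show False
    using assms(1) by blast
qed

lemma vertices_determined_by_heights:
  assumes w: "ccw_polygon N w n \<Gamma>" and v: "ccw_polygon N v n \<Sigma>"
    and eq: "\<And>j. j \<in> {1..int N} \<Longrightarrow> w j \<bullet> n j = v j \<bullet> n j"
    and j: "j \<in> {1..int N}"
  shows "w j = v j"
proof -
  have prev: "(w (i - 1) - v (i - 1)) \<bullet> n i = 0" if "i \<in> {1..int N}" for i
    using eq[OF that] ccw_polygonD(5)[OF w, of i] ccw_polygonD(5)[OF v, of i]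
    by (simp add: inner_diff_left)
  \<comment> \<open>The edge after edge \<open>j\<close>, wrapped around so that its height is among those given.
    Both edges meet in vertex \<open>j\<close>, by the periodicity of the vertices.\<close>
  define k where "k = (if j = int N then 1 else j + 1)"
  have k: "k \<in> {1..int N}" "w (k - 1) = w j" "v (k - 1) = v j" "w (j + 1) = w k"
    using j ccw_polygonD(1)[OF w, of 0] ccw_polygonD(1)[OF v, of 0] ccw_polygonD(1)[OF w, of 1]
    by (auto simp: k_def add.commute)
  have "w j - v j = 0"
  proof (rule orthogonal_to_noncollinear_normals)
    show "\<not> collinear {w (j - 1), w j, w (j + 1)}" "n j \<noteq> 0" "n k \<noteq> 0"
         "(w j - w (j - 1)) \<bullet> n j = 0"
      using ccw_polygonD(3-5)[OF w] by blast+
    show "(w (j + 1) - w j) \<bullet> n k = 0"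
      using ccw_polygonD(5)[OF w, of k] k by simp
    show "(w j - v j) \<bullet> n j = 0"
      using eq[OF j] by (simp add: inner_diff_left)
    show "(w j - v j) \<bullet> n k = 0"
      using prev[OF k(1)] k by simp
  qed
  then show ?thesis
    by simp
qed

lemma heights_inj_on_numbered_class:
  fixes \<kappa> :: "'n::finite \<Rightarrow> int"
  assumes P: "numbered_polygon_class (CARD('n)) P w n"
    and \<kappa>: "bij_betw \<kappa> UNIV {1..int (CARD('n))}"
  shows "inj_on (\<lambda>\<Gamma>. heights \<kappa> n (w \<Gamma>) :: real^'n) P"
proof (rule inj_onI)
  fix \<Gamma> \<Sigma>
  assume \<Gamma>: "\<Gamma> \<in> P" and \<Sigma>: "\<Sigma> \<in> P"
    and eq: "(heights \<kappa> n (w \<Gamma>) :: real^'n) = heights \<kappa> n (w \<Sigma>)"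
  have polys: "ccw_polygon (CARD('n)) (w \<Gamma>) n \<Gamma>" "ccw_polygon (CARD('n)) (w \<Sigma>) n \<Sigma>"
    using P \<Gamma> \<Sigma> by (auto simp: numbered_polygon_class_def)
  have "w \<Gamma> j \<bullet> n j = w \<Sigma> j \<bullet> n j" if "j \<in> {1..int (CARD('n))}" for j
  proof -
    have "j \<in> range \<kappa>"
      using bij_betw_imp_surj_on[OF \<kappa>] that by simp
    then obtain i where "j = \<kappa> i"
      by blast
    then show ?thesis
      using eq by (simp add: heights_def vec_eq_iff)
  qed
  then have same: "w \<Gamma> j = w \<Sigma> j" if "j \<in> {1..int (CARD('n))}" for j
    using vertices_determined_by_heights[OF polys] that by blast
  moreover have "w \<Gamma> 0 = w \<Sigma> 0"
    using ccw_polygonD(1)[OF polys(1), of 0] ccw_polygonD(1)[OF polys(2), of 0]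
      same[of "int (CARD('n))"] by simp
  ultimately have "w \<Gamma> j = w \<Sigma> j" if "j \<in> {0..int (CARD('n))}" for j
    using that by (cases "j = 0") auto
  then have "map (w \<Gamma>) [0..int (CARD('n))] = map (w \<Sigma>) [0..int (CARD('n))]"
    by (intro map_cong) auto
  then show "\<Gamma> = \<Sigma>"
    using ccw_polygonD(2)[OF polys(1)] ccw_polygonD(2)[OF polys(2)] by metis
qed

section \<open>The height function as an embedding into Euclidean space\<close>

locale height_embedding =
  fixes P :: "'a set" and h :: "'a \<Rightarrow> real^'n::finite"
  assumes inj_h: "inj_on h P"
begin

sublocale Metric_space P "hdist h"
proof
  show "0 \<le> hdist h x y" for x y
    by (simp add: hdist_def infnorm_pos_le)
  show "hdist h x y = hdist h y x" for x y
    by (simp add: hdist_def infnorm_sub)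
  show "hdist h x y = 0 \<longleftrightarrow> x = y" if "x \<in> P" "y \<in> P" for x y
    using inj_h that by (auto simp: hdist_def infnorm_eq_0 dest: inj_onD)
  show "hdist h x z \<le> hdist h x y + hdist h y z" for x y z
    using infnorm_triangle[of "h x - h y" "h y - h z"] by (simp add: hdist_def)
qed

text \<open>
  The topology of the class comes from the maximum norm, that of \<open>real^'n\<close> from the Euclidean norm;
  the comparison of the two norms makes the height function a homeomorphism onto its image.
\<close>
lemma continuous_map_h: "continuous_map mtopology euclidean h"
  unfolding continuous_map_from_metric
proof (intro conjI ballI allI impI)
  fix a V assume a: "a \<in> P" and V: "openin euclidean V \<and> h a \<in> V"
  then obtain e where e: "e > 0" "ball (h a) e \<subseteq> V"
    by (meson open_contains_ball open_openin)
  define s where "s = sqrt (real DIM(real^'n))"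
  have s: "s > 0"
    by (simp add: s_def)
  have "h x \<in> V" if "x \<in> P" "hdist h a x < e / s" for x
  proof -
    have "dist (h a) (h x) \<le> s * infnorm (h a - h x)"
      unfolding dist_norm s_def by (rule norm_le_infnorm)
    also have "\<dots> < e"
      using that(2) s by (simp add: hdist_def field_simps)
    finally show ?thesis
      using e(2) by auto
  qed
  then show "\<exists>r>0. \<forall>x. x \<in> P \<and> hdist h a x < r \<longrightarrow> h x \<in> V"
    using e(1) s by (intro exI[of _ "e / s"]) auto
qed simp

lemma continuous_map_inv_h: "continuous_map (top_of_set (h ` P)) mtopology (inv_into P h)"
  unfolding continuous_map_to_metric
proof (intro ballI allI impI)
  fix x and e :: real
  assume x: "x \<in> topspace (top_of_set (h ` P))" and "e > 0"
  let ?V = "h ` P \<inter> ball x e"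
  have "inv_into P h y \<in> mball (inv_into P h x) e" if "y \<in> ?V" for y
  proof -
    have "infnorm (x - y) < e"
      using that infnorm_le_norm[of "x - y"] by (simp add: dist_norm)
    then show ?thesis
      using that x by (simp add: hdist_def inv_into_into f_inv_into_f)
  qed
  then show "\<exists>V. openin (top_of_set (h ` P)) V \<and> x \<in> V \<and>
      (\<forall>y\<in>V. inv_into P h y \<in> mball (inv_into P h x) e)"
    using x \<open>e > 0\<close> by (intro exI[of _ ?V]) auto
qed

lemma compactin_preimage_h:
  assumes "compact S" "S \<subseteq> h ` P"
  shows "compactin mtopology {\<Gamma> \<in> P. h \<Gamma> \<in> S}"
proof -
  have "compactin mtopology (inv_into P h ` S)"
    using assms by (intro image_compactin[OF _ continuous_map_inv_h]) (simp add: compactin_subtopology)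
  moreover have "inv_into P h ` S = {\<Gamma> \<in> P. h \<Gamma> \<in> S}"
  proof
    show "inv_into P h ` S \<subseteq> {\<Gamma> \<in> P. h \<Gamma> \<in> S}"
      using assms(2) by (auto simp: inv_into_into f_inv_into_f subset_iff)
    show "{\<Gamma> \<in> P. h \<Gamma> \<in> S} \<subseteq> inv_into P h ` S"
      using inj_h by (force simp: image_iff)
  qed
  ultimately show ?thesis
    by simp
qed

lemma mem_if_height_mem:
  assumes "U \<subseteq> P" "\<Gamma> \<in> P" "h \<Gamma> \<in> h ` U"
  shows "\<Gamma> \<in> U"
  using assms inj_h by (metis inj_on_image_mem_iff)

text \<open>
  In a general metric space a closed ball can be larger than the closure of the open ball. Here the
  heights fill the open ball, so that a polygon on the boundary can be approached along the segment
  of height vectors towards the centre.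
\<close>
lemma closure_of_mball:
  assumes "\<Gamma> \<in> P" "0 < \<epsilon>" and filled: "\<And>a. infnorm (a - h \<Gamma>) < \<epsilon> \<Longrightarrow> a \<in> h ` P"
  shows "mtopology closure_of (mball \<Gamma> \<epsilon>) = mcball \<Gamma> \<epsilon>"
proof
  show "mtopology closure_of (mball \<Gamma> \<epsilon>) \<subseteq> mcball \<Gamma> \<epsilon>"
    by (intro closure_of_minimal mball_subset_mcball closedin_mcball)
  show "mcball \<Gamma> \<epsilon> \<subseteq> mtopology closure_of (mball \<Gamma> \<epsilon>)"
  proof
    fix \<Sigma> assume \<Sigma>: "\<Sigma> \<in> mcball \<Gamma> \<epsilon>"
    have d: "infnorm (h \<Sigma> - h \<Gamma>) \<le> \<epsilon>" "\<Sigma> \<in> P"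
      using \<Sigma> by (auto simp: hdist_def infnorm_sub)
    have "\<exists>y\<in>mball \<Gamma> \<epsilon>. y \<in> mball \<Sigma> r" if "r > 0" for r
    proof -
      \<comment> \<open>Moving the fraction \<open>s\<close> of the way to the centre costs at most \<open>s * \<epsilon> < r\<close> and
        leads strictly inside the ball.\<close>
      define s where "s = min (1/2) (r / (2 * \<epsilon>))"
      have s: "0 < s" "s < 1" "s * \<epsilon> < r"
        using \<open>r > 0\<close> \<open>0 < \<epsilon>\<close> by (auto simp: s_def min_def field_simps)
      let ?a = "h \<Sigma> + s *\<^sub>R (h \<Gamma> - h \<Sigma>)"
      have "?a - h \<Gamma> = (1 - s) *\<^sub>R (h \<Sigma> - h \<Gamma>)"
        by (simp add: algebra_simps)
      then have "infnorm (?a - h \<Gamma>) = (1 - s) * infnorm (h \<Sigma> - h \<Gamma>)"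
        using s by (simp add: infnorm_mul)
      also have "\<dots> \<le> (1 - s) * \<epsilon>"
        using s d by (intro mult_left_mono) auto
      also have "\<dots> < \<epsilon>"
        using s \<open>0 < \<epsilon>\<close> by (simp add: algebra_simps)
      finally have 1: "infnorm (?a - h \<Gamma>) < \<epsilon>" .
      have "infnorm (?a - h \<Sigma>) = s * infnorm (h \<Sigma> - h \<Gamma>)"
        using s by (simp add: infnorm_mul infnorm_sub)
      also have "\<dots> \<le> s * \<epsilon>"
        using s d by (intro mult_left_mono) auto
      finally have 2: "infnorm (?a - h \<Sigma>) < r"
        using s by simp
      obtain y where "y \<in> P" "h y = ?a"
        using filled[OF 1] by auto
      with 1 2 \<open>\<Gamma> \<in> P\<close> d(2) show ?thesis
        by (intro bexI[of _ y]) (simp_all only: in_mball hdist_def infnorm_sub[of "h \<Gamma>"] infnorm_sub[of "h \<Sigma>"])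
    qed
    then show "\<Sigma> \<in> mtopology closure_of (mball \<Gamma> \<epsilon>)"
      using d(2) by (auto simp only: metric_closure_of)
  qed
qed

text \<open>
  The image of the height function need not be closed, so bounded closed sets of polygons need not
  be compact. What saves compactness is that the compact set \<open>S\<close> of all vectors within distance
  \<open>\<epsilon>\<close> of the heights of \<open>K\<close> lies inside that image.
\<close>
lemma compactin_closure_of_balls:
  assumes "compactin mtopology K"
    and filled: "\<And>\<Gamma> a. \<lbrakk>\<Gamma> \<in> K; infnorm (a - h \<Gamma>) \<le> \<epsilon>\<rbrakk> \<Longrightarrow> a \<in> h ` U"
    and "U \<subseteq> P"
  shows "compactin mtopology (mtopology closure_of (\<Union>\<Sigma>\<in>K. mball \<Sigma> \<epsilon>))"
    and "mtopology closure_of (\<Union>\<Sigma>\<in>K. mball \<Sigma> \<epsilon>) \<subseteq> U"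
proof -
  define S where "S = (\<Union>x\<in>h ` K. \<Union>y\<in>{y. infnorm y \<le> \<epsilon>}. {x + y})"
  have "compact (h ` K)"
    using image_compactin[OF assms(1) continuous_map_h] by simp
  moreover have "compact {y::real^'n. infnorm y \<le> \<epsilon>}"
  proof -
    have "closed {y::real^'n. infnorm y \<le> \<epsilon>}"
      by (intro closed_Collect_le continuous_intros)
    moreover have "bounded {y::real^'n. infnorm y \<le> \<epsilon>}"
      unfolding bounded_iff
    proof (intro exI ballI)
      fix y :: "real^'n" assume "y \<in> {y. infnorm y \<le> \<epsilon>}"
      then show "norm y \<le> sqrt (real DIM(real^'n)) * \<epsilon>"
        by (intro order_trans[OF norm_le_infnorm] mult_left_mono) auto
    qed
    ultimately show ?thesis
      by (simp add: compact_eq_bounded_closed)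
  qed
  ultimately have "compact S"
    unfolding S_def by (rule compact_sums')
  have SU: "S \<subseteq> h ` U"
    using filled by (force simp: S_def)
  define Q where "Q = {\<Gamma> \<in> P. h \<Gamma> \<in> S}"
  have Q: "compactin mtopology Q"
    unfolding Q_def using \<open>compact S\<close> SU \<open>U \<subseteq> P\<close> by (intro compactin_preimage_h) auto
  have "(\<Union>\<Sigma>\<in>K. mball \<Sigma> \<epsilon>) \<subseteq> Q"
  proof safe
    fix \<Sigma> \<Theta> assume "\<Sigma> \<in> K" and \<Theta>: "\<Theta> \<in> mball \<Sigma> \<epsilon>"
    then have "infnorm (h \<Theta> - h \<Sigma>) \<le> \<epsilon>" "\<Theta> \<in> P"
      by (auto simp: hdist_def infnorm_sub)
    then show "\<Theta> \<in> Q"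
      using \<open>\<Sigma> \<in> K\<close> by (force simp: Q_def S_def intro!: bexI[of _ "h \<Theta> - h \<Sigma>"])
  qed
  then have sub: "mtopology closure_of (\<Union>\<Sigma>\<in>K. mball \<Sigma> \<epsilon>) \<subseteq> Q"
    using Q by (intro closure_of_minimal compactin_imp_closedin Hausdorff_space_mtopology) auto
  then show "compactin mtopology (mtopology closure_of (\<Union>\<Sigma>\<in>K. mball \<Sigma> \<epsilon>))"
    using Q by (intro closed_compactin[OF Q]) auto
  show "mtopology closure_of (\<Union>\<Sigma>\<in>K. mball \<Sigma> \<epsilon>) \<subseteq> U"
    using sub SU mem_if_height_mem[OF \<open>U \<subseteq> P\<close>] by (auto simp: Q_def)
qed

end

section \<open>The constants of the scheme\<close>

text \<open>
  The proof is by contradiction because a vector outside \<open>h ` U\<close> is also what makes the infimum in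
  \<open>rho_point\<close> one over a nonempty set.
\<close>
lemma height_mem_image_if_lt_rho:
  fixes h :: "'a \<Rightarrow> real^'n::finite"
  assumes "\<Gamma> \<in> K" "infnorm (a - h \<Gamma>) < rho h K U"
  shows "a \<in> h ` U"
proof (rule ccontr)
  assume a: "a \<notin> h ` U"
  have "0 \<le> rho_point h \<Sigma> U" for \<Sigma>
    unfolding rho_point_def using a by (intro cInf_greatest) (auto simp: infnorm_pos_le)
  then have "rho h K U \<le> rho_point h \<Gamma> U"
    unfolding rho_def using \<open>\<Gamma> \<in> K\<close> by (intro cINF_lower bdd_belowI2[where m = 0]) auto
  also have "\<dots> \<le> infnorm (a - h \<Gamma>)"
    unfolding rho_point_def using a
    by (intro cInf_lower bdd_belowI[where m = 0]) (auto simp: infnorm_pos_le)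
  finally show False
    using assms(2) by simp
qed

text \<open>
  A supremum of reals bounds its set only if that set is bounded above, which here follows from the
  compactness of \<open>K \<times> {0..T}\<close>.
\<close>
lemma infnorm_le_maxF:
  fixes F :: "'a \<Rightarrow> real \<Rightarrow> real^'n::finite"
  assumes K: "compactin X K" "K \<subseteq> U" and T: "{0..T} \<subseteq> J"
    and F: "continuous_map (prod_topology (subtopology X U) (top_of_set J)) euclidean (\<lambda>(\<Gamma>, s). F \<Gamma> s)"
    and "\<Gamma> \<in> K" "s \<in> {0..T}"
  shows "infnorm (F \<Gamma> s) \<le> maxF F K T"
proof -
  have "compactin (prod_topology (subtopology X U) (top_of_set J)) (K \<times> {0..T})"
    using K T by (simp add: compactin_Times compactin_subtopology)
  then have "compact ((\<lambda>(\<Gamma>, s). F \<Gamma> s) ` (K \<times> {0..T}))"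
    using image_compactin[OF _ F] by simp
  then obtain B where B: "\<And>\<Gamma> s. \<Gamma> \<in> K \<Longrightarrow> s \<in> {0..T} \<Longrightarrow> norm (F \<Gamma> s) \<le> B"
    by (force dest!: compact_imp_bounded simp: bounded_iff)
  have "bdd_above {infnorm (F \<Gamma> s) | \<Gamma> s. \<Gamma> \<in> K \<and> s \<in> {0..T}}"
    using B infnorm_le_norm order_trans by (intro bdd_aboveI[where M = B]) blast
  then show ?thesis
    unfolding maxF_def using assms(5,6) by (intro cSup_upper) auto
qed

section \<open>Contractions of compact sets\<close>

context Metric_space
begin

text \<open>
  The error bound in the second part compares the iterates with the fixed point itself, so each
  step contributes one factor \<open>q\<close> and no constant \<open>1 / (1 - q)\<close> arises.
\<close>
lemma contraction_on_compact:
  assumes C: "compactin mtopology C" "C \<noteq> {}"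
    and f: "\<And>x. x \<in> C \<Longrightarrow> f x \<in> C"
    and q: "0 \<le> q" "q < 1"
    and contr: "\<And>x y. \<lbrakk>x \<in> C; y \<in> C\<rbrakk> \<Longrightarrow> d (f x) (f y) \<le> q * d x y"
  shows "\<exists>!x. x \<in> C \<and> f x = x"
    and "\<lbrakk>x \<in> C; f x = x; a \<in> C\<rbrakk> \<Longrightarrow> d x ((f ^^ \<nu>) a) \<le> q ^ \<nu> * d x a"
    and "\<lbrakk>x \<in> C; f x = x; a \<in> C\<rbrakk> \<Longrightarrow> limitin mtopology (\<lambda>\<nu>. (f ^^ \<nu>) a) x sequentially"
proof -
  have CM: "C \<subseteq> M"
    using compactin_subset_topspace[OF C(1)] by simp
  interpret Submetric M d C
    using CM by unfold_locales
  obtain z where z: "z \<in> C" "f z = z"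
    using sub.Banach_fixedpoint_thm[OF compactin_imp_mcomplete[OF C(1)] C(2) _ q(2), of f] f contr
    by blast
  show "\<exists>!x. x \<in> C \<and> f x = x"
  proof (rule ex1I[of _ z])
    fix y assume y: "y \<in> C \<and> f y = y"
    then have "d y z \<le> q * d y z"
      using contr[of y z] z by simp
    then have "d y z * (1 - q) \<le> 0"
      by (simp add: algebra_simps)
    then have "d y z \<le> 0"
      using q(2) by (simp add: mult_le_0_iff)
    then show "y = z"
      using y z CM by (metis nonneg order_antisym subsetD zero)
  qed (use z in simp)
  assume x: "x \<in> C" "f x = x" and a: "a \<in> C"
  have iter: "(f ^^ \<nu>) a \<in> C" for \<nu>
    by (induction \<nu>) (use a f in auto)
  show bound: "d x ((f ^^ \<nu>) a) \<le> q ^ \<nu> * d x a" for \<nu>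
  proof (induction \<nu>)
    case (Suc \<nu>)
    have "d x ((f ^^ Suc \<nu>) a) \<le> q * d x ((f ^^ \<nu>) a)"
      using contr[OF x(1) iter[of \<nu>]] x(2) by simp
    also have "\<dots> \<le> q * (q ^ \<nu> * d x a)"
      using Suc.IH q(1) by (rule mult_left_mono)
    finally show ?case
      by simp
  qed simp
  have "(\<lambda>\<nu>. q ^ \<nu> * d x a) \<longlonglongrightarrow> 0"
    using q by (auto intro!: tendsto_eq_intros LIMSEQ_realpow_zero)
  then have "(\<lambda>\<nu>. d ((f ^^ \<nu>) a) x) \<longlonglongrightarrow> 0"
    by (rule tendsto_sandwich[rotated 2, OF tendsto_const])
       (use bound in \<open>simp_all add: commute[of _ x]\<close>)
  then show "limitin mtopology (\<lambda>\<nu>. (f ^^ \<nu>) a) x sequentially"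
    using x iter CM by (auto simp: limitin_metric_dist_null subset_iff)
qed

end

section \<open>The implicit midpoint step\<close>

theorem theorem4p4:
  fixes P :: "(real^2) set set"
    and w :: "(real^2) set \<Rightarrow> int \<Rightarrow> real^2"
    and n :: "int \<Rightarrow> real^2"
    and \<kappa> :: "'n::finite \<Rightarrow> int"
    and h :: "(real^2) set \<Rightarrow> real^'n"
    and U K K\<^sub>\<epsilon> C :: "(real^2) set set"
    and Tstar :: ereal
    and T \<epsilon> lam \<tau> t_half :: real
    and F :: "(real^2) set \<Rightarrow> real \<Rightarrow> real^'n"
    and L :: "(real^2) set set \<Rightarrow> real \<Rightarrow> real"
    and t :: "nat \<Rightarrow> real"
    and m mbar :: nat
    and \<Gamma>\<^sub>m :: "(real^2) set"
    and \<Lambda> :: "(real^2) set \<Rightarrow> (real^2) set"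
  assumes "numbered_polygon_class (CARD('n)) P w n"
    and "bij_betw \<kappa> UNIV {1..int (CARD('n))}"
    and h_def: "h = (\<lambda>\<Gamma>. heights \<kappa> n (w \<Gamma>))"
    and "openin (htopology P h) U"
    and "0 < Tstar" and "0 < T" and "ereal T < Tstar"
    and "continuous_map
           (prod_topology (subtopology (htopology P h) U)
                          (top_of_set {s. 0 \<le> s \<and> ereal s < Tstar}))
           euclidean (\<lambda>(\<Gamma>, s). F \<Gamma> s)"
    and "locally_Lipschitz_with P h U Tstar F L"
    and "compactin (htopology P h) K" and "K \<subseteq> U"
    and "0 < \<epsilon>" and "\<epsilon> < rho h K U"
    and K\<epsilon>_def: "K\<^sub>\<epsilon> = (htopology P h) closure_of (\<Union>\<Sigma>\<in>K. hball P h \<Sigma> \<epsilon>)"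
    and "t 0 = 0" and "\<And>i. i < mbar \<Longrightarrow> t i < t (Suc i)" and "t mbar \<le> T"
    and "m < mbar"
    and \<tau>_def: "\<tau> = t (Suc m) - t m"
    and t_half_def: "t_half = t m + \<tau> / 2"
    and "\<Gamma>\<^sub>m \<in> K"
    and "0 < lam" and "lam < 1"
    and "0 < maxF F K\<^sub>\<epsilon> T"
    and "\<tau> \<le> min (\<epsilon> / maxF F K\<^sub>\<epsilon> T) (2 * lam / L K\<^sub>\<epsilon> T)"
    and C_def: "C = (htopology P h) closure_of (hball P h \<Gamma>\<^sub>m \<epsilon>)"
    and \<Lambda>_def: "\<Lambda> = (\<lambda>\<Sigma>. THE \<Theta>. \<Theta> \<in> U \<and>
                   h \<Theta> = h \<Gamma>\<^sub>m + \<tau> *\<^sub>R F (interpolation P h \<Gamma>\<^sub>m \<Sigma>) t_half)"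
  shows "(\<forall>\<Sigma>\<in>C. (\<exists>!\<Theta>. is_interpolation P h \<Gamma>\<^sub>m \<Sigma> \<Theta>) \<and> interpolation P h \<Gamma>\<^sub>m \<Sigma> \<in> U) \<and>
    (\<exists>!\<Gamma>'. \<Gamma>' \<in> C \<and>
       h \<Gamma>' = h \<Gamma>\<^sub>m + \<tau> *\<^sub>R F (interpolation P h \<Gamma>\<^sub>m \<Gamma>') t_half) \<and>
    (\<forall>\<Sigma>\<in>C. \<exists>!\<Theta>. \<Theta> \<in> U \<and>
       h \<Theta> = h \<Gamma>\<^sub>m + \<tau> *\<^sub>R F (interpolation P h \<Gamma>\<^sub>m \<Sigma>) t_half) \<and>
    \<Lambda> ` C \<subseteq> C \<and>
    (\<exists>q. 0 \<le> q \<and> q < 1 \<and>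
       (\<forall>\<Sigma>\<in>C. \<forall>\<Sigma>'\<in>C. hdist h (\<Lambda> \<Sigma>) (\<Lambda> \<Sigma>') \<le> q * hdist h \<Sigma> \<Sigma>')) \<and>
    (\<forall>\<Gamma>'\<in>C. h \<Gamma>' = h \<Gamma>\<^sub>m + \<tau> *\<^sub>R F (interpolation P h \<Gamma>\<^sub>m \<Gamma>') t_half \<longrightarrow>
       \<Lambda> \<Gamma>' = \<Gamma>' \<and>
       limitin (htopology P h) (\<lambda>\<nu>. (\<Lambda> ^^ \<nu>) \<Gamma>\<^sub>m) \<Gamma>' sequentially \<and>
       (\<forall>\<nu>. hdist h \<Gamma>' ((\<Lambda> ^^ \<nu>) \<Gamma>\<^sub>m) \<le> lam ^ \<nu> * hdist h \<Gamma>' \<Gamma>\<^sub>m))"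
proof -
  interpret height_embedding P h
    unfolding h_def using heights_inj_on_numbered_class[OF assms(1,2)] by unfold_locales
  note htop = htopology_def[of P h] hball_def[of P h]
  have "U \<subseteq> P"
    using openin_subset[OF \<open>openin (htopology P h) U\<close>] by (simp add: htop)
  have \<Gamma>P: "\<Gamma>\<^sub>m \<in> P"
    using \<open>\<Gamma>\<^sub>m \<in> K\<close> \<open>K \<subseteq> U\<close> \<open>U \<subseteq> P\<close> by blast
  have filled: "a \<in> h ` U" if "\<Gamma> \<in> K" "infnorm (a - h \<Gamma>) \<le> \<epsilon>" for a \<Gamma>
    using height_mem_image_if_lt_rho[OF that(1), of a h U] that(2) \<open>\<epsilon> < rho h K U\<close> by simp
  have C: "C = mcball \<Gamma>\<^sub>m \<epsilon>"
    unfolding C_def htop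
    using filled[OF \<open>\<Gamma>\<^sub>m \<in> K\<close>] \<open>U \<subseteq> P\<close> by (intro closure_of_mball \<Gamma>P \<open>0 < \<epsilon>\<close>) force
  have K\<epsilon>: "compactin mtopology K\<^sub>\<epsilon>" "K\<^sub>\<epsilon> \<subseteq> U"
    using compactin_closure_of_balls[OF _ filled \<open>U \<subseteq> P\<close>] \<open>compactin (htopology P h) K\<close>
    by (simp_all add: K\<epsilon>_def htop)
  have balls: "(\<Union>\<Sigma>\<in>K. mball \<Sigma> \<epsilon>) \<subseteq> K\<^sub>\<epsilon>"
    unfolding K\<epsilon>_def htop by (intro closure_of_subset) auto
  have "closedin mtopology C"
    by (simp add: C)
  moreover have "C \<subseteq> K\<^sub>\<epsilon>"
    using \<open>\<Gamma>\<^sub>m \<in> K\<close> unfolding C_def K\<epsilon>_def by (intro closure_of_mono) blast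
  ultimately have "compactin mtopology C"
    using closed_compactin[OF K\<epsilon>(1)] by blast

  have "0 \<le> t m" "t (Suc m) \<le> T" "0 < \<tau>"
  proof -
    have mono: "t i \<le> t j" if "i \<le> j" "j \<le> mbar" for i j
      using that
    proof (induction j rule: dec_induct)
      case (step k)
      then show ?case
        using assms(16)[of k] by simp
    qed simp
    show "0 < \<tau>"
      using assms(16)[OF \<open>m < mbar\<close>] by (simp add: \<tau>_def)
    show "0 \<le> t m"
      using mono[of 0 m] \<open>m < mbar\<close> \<open>t 0 = 0\<close> by simp
    show "t (Suc m) \<le> T"
      using mono[of "Suc m" mbar] \<open>m < mbar\<close> \<open>t mbar \<le> T\<close> by simp
  qed
  then have t_half: "t_half \<in> {0..T}"
    by (simp add: t_half_def \<tau>_def field_simps)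

  have C_iff: "\<Sigma> \<in> C \<longleftrightarrow> \<Sigma> \<in> P \<and> infnorm (h \<Sigma> - h \<Gamma>\<^sub>m) \<le> \<epsilon>" for \<Sigma>
    using \<Gamma>P by (simp add: C hdist_def infnorm_sub[of "h \<Gamma>\<^sub>m"])
  have "C \<subseteq> U"
    using \<open>C \<subseteq> K\<^sub>\<epsilon>\<close> K\<epsilon>(2) by blast

  \<comment> \<open>The midpoint of \<open>\<Gamma>\<^sub>m\<close> and a member of the closed ball has distance at most
    \<open>\<epsilon> / 2\<close> from \<open>\<Gamma>\<^sub>m\<close>, so it exists and lies in the open ball, hence in \<open>K\<^sub>\<epsilon>\<close>.\<close>
  define I where "I = interpolation P h \<Gamma>\<^sub>m"
  have interp: "\<exists>!\<Theta>. is_interpolation P h \<Gamma>\<^sub>m \<Sigma> \<Theta>"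
    and I_height: "h (I \<Sigma>) = (1/2) *\<^sub>R (h \<Gamma>\<^sub>m + h \<Sigma>)"
    and I_K\<epsilon>: "I \<Sigma> \<in> K\<^sub>\<epsilon>"
    if "\<Sigma> \<in> C" for \<Sigma>
  proof -
    let ?a = "(1/2) *\<^sub>R (h \<Gamma>\<^sub>m + h \<Sigma>)"
    have "?a - h \<Gamma>\<^sub>m = (1/2) *\<^sub>R (h \<Sigma> - h \<Gamma>\<^sub>m)"
      by (simp add: vec_eq_iff field_simps)
    then have "infnorm (?a - h \<Gamma>\<^sub>m) = infnorm (h \<Sigma> - h \<Gamma>\<^sub>m) / 2"
      by (simp add: infnorm_mul)
    then have a: "infnorm (?a - h \<Gamma>\<^sub>m) < \<epsilon>"
      using that \<open>0 < \<epsilon>\<close> by (simp add: C_iff)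
    then obtain \<Theta> where "\<Theta> \<in> P" "h \<Theta> = ?a"
      using filled[OF \<open>\<Gamma>\<^sub>m \<in> K\<close>, of ?a] \<open>U \<subseteq> P\<close> by fastforce
    then show ex1: "\<exists>!\<Theta>. is_interpolation P h \<Gamma>\<^sub>m \<Sigma> \<Theta>"
      using inj_onD[OF inj_h] unfolding is_interpolation_def by (intro ex1I[of _ \<Theta>]) auto
    have "is_interpolation P h \<Gamma>\<^sub>m \<Sigma> (I \<Sigma>)"
      unfolding I_def interpolation_def by (rule theI'[OF ex1])
    then have I: "I \<Sigma> \<in> P" "h (I \<Sigma>) = ?a"
      by (auto simp: is_interpolation_def)
    then show "h (I \<Sigma>) = ?a"
      by simp
    have "I \<Sigma> \<in> mball \<Gamma>\<^sub>m \<epsilon>"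
      using I(1) a \<Gamma>P by (simp add: hdist_def I(2) infnorm_sub[of "h \<Gamma>\<^sub>m"])
    then show "I \<Sigma> \<in> K\<^sub>\<epsilon>"
      using balls \<open>\<Gamma>\<^sub>m \<in> K\<close> by blast
  qed

  have bound: "infnorm (\<tau> *\<^sub>R F (I \<Sigma>) t_half) \<le> \<epsilon>" if "\<Sigma> \<in> C" for \<Sigma>
  proof -
    have "ereal s < Tstar" if "s \<le> T" for s
      using that \<open>ereal T < Tstar\<close> by (meson ereal_less_eq(3) le_less_trans)
    then have "infnorm (F (I \<Sigma>) t_half) \<le> maxF F K\<^sub>\<epsilon> T"
      using assms(8) unfolding htop by (intro infnorm_le_maxF[OF K\<epsilon> _ _ I_K\<epsilon>[OF that] t_half]) auto
    then have "\<tau> * infnorm (F (I \<Sigma>) t_half) \<le> \<tau> * maxF F K\<^sub>\<epsilon> T"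
      using \<open>0 < \<tau>\<close> by simp
    also have "\<dots> \<le> \<epsilon>"
      using assms(24,25) by (simp add: field_simps)
    finally show ?thesis
      using \<open>0 < \<tau>\<close> by (simp add: infnorm_mul)
  qed

  have \<Lambda>_ex1: "\<exists>!\<Theta>. \<Theta> \<in> U \<and> h \<Theta> = h \<Gamma>\<^sub>m + \<tau> *\<^sub>R F (I \<Sigma>) t_half" if "\<Sigma> \<in> C" for \<Sigma>
  proof -
    have "h \<Gamma>\<^sub>m + \<tau> *\<^sub>R F (I \<Sigma>) t_half \<in> h ` U"
      using bound[OF that] by (intro filled[OF \<open>\<Gamma>\<^sub>m \<in> K\<close>]) simp
    then obtain \<Theta> where "\<Theta> \<in> U" "h \<Theta> = h \<Gamma>\<^sub>m + \<tau> *\<^sub>R F (I \<Sigma>) t_half"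
      by auto
    then show ?thesis
      using inj_onD[OF inj_on_subset[OF inj_h \<open>U \<subseteq> P\<close>]] by (intro ex1I[of _ \<Theta>]) auto
  qed
  have \<Lambda>: "\<Lambda> \<Sigma> \<in> U" "h (\<Lambda> \<Sigma>) = h \<Gamma>\<^sub>m + \<tau> *\<^sub>R F (I \<Sigma>) t_half" if "\<Sigma> \<in> C" for \<Sigma>
    using theI'[OF \<Lambda>_ex1[OF that]] by (simp_all add: \<Lambda>_def I_def)
  have \<Lambda>_C: "\<Lambda> \<Sigma> \<in> C" if "\<Sigma> \<in> C" for \<Sigma>
    using \<Lambda>[OF that] bound[OF that] \<open>U \<subseteq> P\<close> by (auto simp: C_iff)
  have fixed_iff: "\<Lambda> \<Sigma> = \<Sigma> \<longleftrightarrow> h \<Sigma> = h \<Gamma>\<^sub>m + \<tau> *\<^sub>R F (I \<Sigma>) t_half" if "\<Sigma> \<in> C" for \<Sigma>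
  proof
    assume "\<Lambda> \<Sigma> = \<Sigma>"
    then show "h \<Sigma> = h \<Gamma>\<^sub>m + \<tau> *\<^sub>R F (I \<Sigma>) t_half"
      using \<Lambda>(2)[OF that] by simp
  next
    assume "h \<Sigma> = h \<Gamma>\<^sub>m + \<tau> *\<^sub>R F (I \<Sigma>) t_half"
    then have "h (\<Lambda> \<Sigma>) = h \<Sigma>"
      using \<Lambda>(2)[OF that] by simp
    then show "\<Lambda> \<Sigma> = \<Sigma>"
      using inj_onD[OF inj_h] \<Lambda>(1)[OF that] that \<open>C \<subseteq> U\<close> \<open>U \<subseteq> P\<close> by blast
  qed

  have Lip: "0 < L K\<^sub>\<epsilon> T"
      "\<And>\<Gamma> \<Sigma> s. \<lbrakk>\<Gamma> \<in> K\<^sub>\<epsilon>; \<Sigma> \<in> K\<^sub>\<epsilon>; s \<in> {0..T}\<rbrakk> \<Longrightarrow>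
        infnorm (F \<Gamma> s - F \<Sigma> s) \<le> L K\<^sub>\<epsilon> T * hdist h \<Gamma> \<Sigma>"
    using assms(9) K\<epsilon> \<open>0 < T\<close> \<open>ereal T < Tstar\<close>
    by (auto simp: locally_Lipschitz_with_def htop)
  have contr: "hdist h (\<Lambda> \<Sigma>) (\<Lambda> \<Sigma>') \<le> lam * hdist h \<Sigma> \<Sigma>'" if "\<Sigma> \<in> C" "\<Sigma>' \<in> C" for \<Sigma> \<Sigma>'
  proof -
    have "h (I \<Sigma>) - h (I \<Sigma>') = (1/2) *\<^sub>R (h \<Sigma> - h \<Sigma>')"
      using that by (simp add: I_height algebra_simps)
    then have half: "hdist h (I \<Sigma>) (I \<Sigma>') = hdist h \<Sigma> \<Sigma>' / 2"
      by (simp add: hdist_def infnorm_mul)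
    have "h (\<Lambda> \<Sigma>) - h (\<Lambda> \<Sigma>') = \<tau> *\<^sub>R (F (I \<Sigma>) t_half - F (I \<Sigma>') t_half)"
      using that by (simp add: \<Lambda> algebra_simps)
    then have "hdist h (\<Lambda> \<Sigma>) (\<Lambda> \<Sigma>') = \<tau> * infnorm (F (I \<Sigma>) t_half - F (I \<Sigma>') t_half)"
      using \<open>0 < \<tau>\<close> by (simp add: hdist_def infnorm_mul)
    also have "\<dots> \<le> \<tau> * (L K\<^sub>\<epsilon> T * (hdist h \<Sigma> \<Sigma>' / 2))"
      using Lip(2)[OF I_K\<epsilon>[OF that(1)] I_K\<epsilon>[OF that(2)] t_half] \<open>0 < \<tau>\<close> by (simp add: half)
    also have "\<dots> = (\<tau> * L K\<^sub>\<epsilon> T / 2) * hdist h \<Sigma> \<Sigma>'"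
      by simp
    also have "\<dots> \<le> lam * hdist h \<Sigma> \<Sigma>'"
      using assms(25) Lip(1) by (intro mult_right_mono) (simp_all add: field_simps)
    finally show ?thesis .
  qed

  have \<Gamma>C: "\<Gamma>\<^sub>m \<in> C"
    using \<Gamma>P \<open>0 < \<epsilon>\<close> by (simp add: C)
  have "0 \<le> lam" "C \<noteq> {}"
    using \<open>0 < lam\<close> \<Gamma>C by auto
  note Banach = contraction_on_compact[OF \<open>compactin mtopology C\<close> \<open>C \<noteq> {}\<close> \<Lambda>_C
      \<open>0 \<le> lam\<close> \<open>lam < 1\<close> contr]
  show ?thesis
    unfolding I_def[symmetric] htop
  proof (intro conjI ballI impI allI)
    show "\<exists>!\<Theta>. is_interpolation P h \<Gamma>\<^sub>m \<Sigma> \<Theta>" if "\<Sigma> \<in> C" for \<Sigma>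
      using interp[OF that] .
    show "I \<Sigma> \<in> U" if "\<Sigma> \<in> C" for \<Sigma>
      using I_K\<epsilon>[OF that] K\<epsilon>(2) by blast
    show "\<exists>!\<Gamma>'. \<Gamma>' \<in> C \<and> h \<Gamma>' = h \<Gamma>\<^sub>m + \<tau> *\<^sub>R F (I \<Gamma>') t_half"
      using Banach(1) by (simp add: fixed_iff cong: conj_cong)
    show "\<exists>!\<Theta>. \<Theta> \<in> U \<and> h \<Theta> = h \<Gamma>\<^sub>m + \<tau> *\<^sub>R F (I \<Sigma>) t_half" if "\<Sigma> \<in> C" for \<Sigma>
      using \<Lambda>_ex1[OF that] .
    show "\<Lambda> ` C \<subseteq> C"
      using \<Lambda>_C by blast
    show "\<exists>q\<ge>0. q < 1 \<and> (\<forall>\<Sigma>\<in>C. \<forall>\<Sigma>'\<in>C. hdist h (\<Lambda> \<Sigma>) (\<Lambda> \<Sigma>') \<le> q * hdist h \<Sigma> \<Sigma>')"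
      using \<open>0 \<le> lam\<close> \<open>lam < 1\<close> contr by blast
    fix \<Gamma>' assume \<Gamma>': "\<Gamma>' \<in> C" and "h \<Gamma>' = h \<Gamma>\<^sub>m + \<tau> *\<^sub>R F (I \<Gamma>') t_half"
    then show fixed: "\<Lambda> \<Gamma>' = \<Gamma>'"
      using fixed_iff by blast
    show "limitin mtopology (\<lambda>\<nu>. (\<Lambda> ^^ \<nu>) \<Gamma>\<^sub>m) \<Gamma>' sequentially"
      using Banach(3)[OF _ _ _ \<Gamma>' fixed \<Gamma>C] by blast
    show "hdist h \<Gamma>' ((\<Lambda> ^^ \<nu>) \<Gamma>\<^sub>m) \<le> lam ^ \<nu> * hdist h \<Gamma>' \<Gamma>\<^sub>m" for \<nu>
      using Banach(2)[OF _ _ _ \<Gamma>' fixed \<Gamma>C] by blast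
  qed
qed

end
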